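(* Let $(q,n)$ be a Dickson pair with $q=p^l$, $p$ prime, and $n>2$; let $g$ be a primitive element of $\mathbb{F}_{q^n}$ and $b\in DN_g(q,n)$. Let $\mathbf{B}$ be a basis of the vector space $D(1,b)$ over $\mathbb{F}_p$. Then $D(1,b)$ is not closed under the field multiplication if and only if there are $u_i,u_j\in\mathbf{B}$ (possibly equal) such that $u_iu_j\notin D(1,b)$.
   Context: A pair $(q,n)$ of positive integers is a Dickson pair if $q=p^l$ is a power of a prime $p$, every prime divisor of $n$ divides $q-1$, and $4\nmid n$ whenever $q\equiv 3\pmod 4$. Let $g$ be a primitive element of $\mathbb{F}_{q^n}$ (a generator of $\mathbb{F}_{q^n}^*$) and let $H=\langle g^n\rangle\le \mathbb{F}_{q^n}^*$. The cosets $g^{\frac{q^k-1}{q-1}}H$, $0\le k\le n-1$, are exactly the $n$ distinct cosets of $H$ in $\mathbb{F}_{q^n}^*$. The Dickson nearfield $DN_g(q,n)=(\mathbb{F}_{q^n},+,\circ)$ has the addition of the field and multiplication $0\circ y=0$, and $x\circ y=x\cdot y^{q^k}$ if $x\in g^{\frac{q^k-1}{q-1}}H$ (so $\circ$ is left distributive: $x\circ(y+z)=x\circ y+x\circ z$). Here $\cdot$ (or juxtaposition) and powers refer to the field multiplication. For $a,b\in DN_g(q,n)$ the generalized distributive set is $D(a,b)=\{d\in DN_g(q,n)\mid (a+b)\circ d=a\circ d+b\circ d\}$; it is an additive subgroup, hence an $\mathbb{F}_p$-subspace, of $\mathbb{F}_{q^n}$. *)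

theory Defs
  imports "HOL-Computational_Algebra.Primes" "HOL-Algebra.Generated_Fields" "HOL-Algebra.Embedded_Algebras"
begin

definition dickson_pair :: "nat \<Rightarrow> nat \<Rightarrow> bool" where
  "dickson_pair q n \<longleftrightarrow>
     n > 0 \<and>
     (\<exists>p l. Factorial_Ring.prime p \<and> l > 0 \<and> q = p ^ l) \<and>
     (\<forall>r. Factorial_Ring.prime r \<and> r dvd n \<longrightarrow> r dvd q - 1) \<and>
     (q mod 4 = 3 \<longrightarrow> \<not> 4 dvd n)"

definition primitive_element :: "('a, 'm) ring_scheme \<Rightarrow> 'a \<Rightarrow> bool" where
  "primitive_element R g \<longleftrightarrow>
     g \<in> carrier (mult_of R) \<and> generate (mult_of R) {g} = carrier (mult_of R)"

definition dickson_coset :: "('a, 'm) ring_scheme \<Rightarrow> nat \<Rightarrow> nat \<Rightarrow> 'a \<Rightarrow> nat \<Rightarrow> 'a set" where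
  "dickson_coset R q n g k =
     (g [^]\<^bsub>R\<^esub> ((q ^ k - 1) div (q - 1))) <#\<^bsub>mult_of R\<^esub> generate (mult_of R) {g [^]\<^bsub>R\<^esub> n}"

text \<open>For a Dickson pair, a field \<open>R\<close> of order \<open>q ^ n\<close> and a primitive element \<open>g\<close>, the cosets
  for \<open>k < n\<close> partition the nonzero elements, so the description below determines \<open>k\<close> uniquely.
  The division in the exponent above is exact for \<open>q \<ge> 2\<close>.\<close>

definition dickson_index :: "('a, 'm) ring_scheme \<Rightarrow> nat \<Rightarrow> nat \<Rightarrow> 'a \<Rightarrow> 'a \<Rightarrow> nat" where
  "dickson_index R q n g x = (THE k. k < n \<and> x \<in> dickson_coset R q n g k)"

definition dickson_mult :: "('a, 'm) ring_scheme \<Rightarrow> nat \<Rightarrow> nat \<Rightarrow> 'a \<Rightarrow> 'a \<Rightarrow> 'a \<Rightarrow> 'a" where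
  "dickson_mult R q n g x y =
     (if x = \<zero>\<^bsub>R\<^esub> then \<zero>\<^bsub>R\<^esub> else x \<otimes>\<^bsub>R\<^esub> (y [^]\<^bsub>R\<^esub> (q ^ dickson_index R q n g x)))"

text \<open>The record type is reused for its signature only; the nearfield is in general not a ring.\<close>

definition dickson_nearfield ::
    "('a, 'm) ring_scheme \<Rightarrow> nat \<Rightarrow> nat \<Rightarrow> 'a \<Rightarrow> ('a, 'm) ring_scheme" where
  "dickson_nearfield R q n g = R\<lparr>mult := dickson_mult R q n g\<rparr>"

definition gen_dist_set :: "('a, 'm) ring_scheme \<Rightarrow> 'a \<Rightarrow> 'a \<Rightarrow> 'a set" where
  "gen_dist_set N a b =
     {d \<in> carrier N. (a \<oplus>\<^bsub>N\<^esub> b) \<otimes>\<^bsub>N\<^esub> d = (a \<otimes>\<^bsub>N\<^esub> d) \<oplus>\<^bsub>N\<^esub> (b \<otimes>\<^bsub>N\<^esub> d)}"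

definition prime_subfield :: "('a, 'm) ring_scheme \<Rightarrow> 'a set" where
  "prime_subfield R = generate_field R {}"

text \<open>The scalars \<open>K\<close> act by the multiplication of \<open>R\<close>. The library's linear independence is a
  predicate on lists and entails distinctness, so \<open>Us\<close> enumerates \<open>B\<close> without repetition.\<close>

definition is_basis_over :: "('a, 'm) ring_scheme \<Rightarrow> 'a set \<Rightarrow> 'a set \<Rightarrow> 'a set \<Rightarrow> bool" where
  "is_basis_over R K V B \<longleftrightarrow>
     (\<exists>Us. set Us = B \<and> ring.independent R K Us \<and> ring.Span R K Us = V)"

end

theory Submission
  imports Defs
begin

text \<open>Field multiplication is bilinear over the prime field, and D(1,b) is the span of
  \<open>B\<close>. A product of two elements of D(1,b) is therefore a combination of products of
  basis elements; if all of those lie in D(1,b), so does the product. Conversely, \<open>B\<close>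
  lies in D(1,b), so a bad pair of basis elements already refutes closure. The bilinear extension is
  \<open>Span_mult_closed\<close>, obtained from linearity in one factor,
  \<open>mult_Span_closed\<close>.\<close>

context cring
begin

text \<open>Multiplication by \<open>a\<close> is \<open>K\<close>-linear, so the preimage
  \<open>?E\<close> of \<open>Span K Vs\<close> under it is a subspace, and one that contains
  \<open>Us\<close> contains its span.\<close>

lemma mult_Span_closed:
  assumes "subfield K R" "set Us \<subseteq> carrier R" "set Vs \<subseteq> carrier R" "a \<in> carrier R"
    and closed: "\<And>u. u \<in> set Us \<Longrightarrow> a \<otimes> u \<in> Span K Vs"
    and "x \<in> Span K Us"
  shows "a \<otimes> x \<in> Span K Vs"
proof -
  note K = subfieldE(3)[OF assms(1)]
  note props = Span_subgroup_props[OF assms(1,3)]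
  let ?E = "{x \<in> carrier R. a \<otimes> x \<in> Span K Vs}"
  have "subgroup ?E (add_monoid R)"
  proof (rule add.subgroupI)
    show "?E \<noteq> {}"
      using props(2) assms(4) by (auto simp del: Span.simps intro!: exI[of _ \<zero>])
  qed (use props(3,4) assms(4) in \<open>auto simp del: Span.simps simp: r_distr r_minus a_inv_def[symmetric]\<close>)
  \<comment> \<open>\<open>Span_min\<close> asks only for an additive subgroup containing the scalar
    multiples of the generators, so scalars need checking on \<open>Us\<close> alone.\<close>
  moreover have "K <#> set Us \<subseteq> ?E"
  proof
    fix y assume "y \<in> K <#> set Us"
    then obtain k u where y: "k \<in> K" "u \<in> set Us" "y = k \<otimes> u"
      by (auto simp: set_mult_def)
    then have "k \<otimes> (a \<otimes> u) \<in> Span K Vs"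
      using Span_smult_closed[OF assms(1,3)] closed by blast
    then show "y \<in> ?E"
      using y K assms(2,4) by (auto simp del: Span.simps simp: m_lcomm subset_iff)
  qed
  ultimately show ?thesis
    using Span_min[OF assms(1,2)] assms(6) by blast
qed

text \<open>Linearity is used once per factor: fixing \<open>x\<close> reduces \<open>y\<close> to a
  generator \<open>u\<close>; commutativity then lets \<open>u\<close> be the fixed factor, which
  reduces \<open>x\<close> to a generator as well.\<close>

lemma Span_mult_closed:
  assumes "subfield K R" "set Us \<subseteq> carrier R"
    and closed: "\<And>u v. \<lbrakk> u \<in> set Us; v \<in> set Us \<rbrakk> \<Longrightarrow> u \<otimes> v \<in> Span K Us"
    and "x \<in> Span K Us" "y \<in> Span K Us"
  shows "x \<otimes> y \<in> Span K Us"
proof (rule mult_Span_closed[OF assms(1,2,2) _ _ assms(5)])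
  show x: "x \<in> carrier R"
    using Span_subgroup_props(1)[OF assms(1,2)] assms(4) by blast
  fix u assume u: "u \<in> set Us"
  then have "u \<in> carrier R"
    using assms(2) by blast
  moreover from this have "u \<otimes> x \<in> Span K Us"
    by (rule mult_Span_closed[OF assms(1,2,2) _ closed[OF u] assms(4)])
  ultimately show "x \<otimes> u \<in> Span K Us"
    using x m_comm by metis
qed

end

theorem lemma8:
  fixes R :: "('a, 'm) ring_scheme"
    and p l q n :: nat
    and g b :: 'a
    and B :: "'a set"
  assumes "dickson_pair q n"
    and "Factorial_Ring.prime p"
    and "q = p ^ l"
    and "n > 2"
    and "field R"
    and "order R = q ^ n"
    and "primitive_element R g"
    and "b \<in> carrier (dickson_nearfield R q n g)"
    and "is_basis_over R (prime_subfield R)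
           (gen_dist_set (dickson_nearfield R q n g) \<one>\<^bsub>R\<^esub> b) B"
  shows "\<not> (\<forall>x \<in> gen_dist_set (dickson_nearfield R q n g) \<one>\<^bsub>R\<^esub> b.
              \<forall>y \<in> gen_dist_set (dickson_nearfield R q n g) \<one>\<^bsub>R\<^esub> b.
                x \<otimes>\<^bsub>R\<^esub> y \<in> gen_dist_set (dickson_nearfield R q n g) \<one>\<^bsub>R\<^esub> b)
         \<longleftrightarrow> (\<exists>u \<in> B. \<exists>v \<in> B.
                u \<otimes>\<^bsub>R\<^esub> v \<notin> gen_dist_set (dickson_nearfield R q n g) \<one>\<^bsub>R\<^esub> b)"
  (is "\<not> (\<forall>x \<in> ?D. \<forall>y \<in> ?D. _) \<longleftrightarrow> _")
proof -
  interpret field R by (rule assms(5))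
  let ?K = "prime_subfield R"
  have K: "subfield ?K R"
    unfolding prime_subfield_def by (rule generate_field_is_subfield) simp
  obtain Us where Us: "set Us = B" "independent ?K Us" "Span ?K Us = ?D"
    using assms(9) unfolding is_basis_over_def by blast
  have carr: "set Us \<subseteq> carrier R"
    by (rule independent_in_carrier[OF Us(2)])
  \<comment> \<open>This gives the direction from right to left; the other is the contrapositive of
    \<open>Span_mult_closed\<close>.\<close>
  have "B \<subseteq> ?D"
    using Span_base_incl[OF K carr] Us by blast
  then show ?thesis
    using Span_mult_closed[OF K carr] unfolding Us by blast
qed

end
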